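(* Let $C$ be a smooth projective curve of genus $2$ defined over $\mathbb{Q}$, and assume that $C$ has exactly four $\mathbb{Q}$-rational Weierstrass points. If $C$ is described by a globally minimal Weierstrass equation of the form $E:\ y^2+Q(x)y=P(x)$ with $P,Q\in\mathbb{Z}[x]$, $\deg Q(x)\le 2$ and $P(x)$ monic of degree $5$, then $|\Delta_E|$ is never an odd prime.
   Context: A Weierstrass equation of a genus two curve $C$ over $\mathbb{Q}$ is an equation $y^2+Q(x)y=P(x)$ with $P,Q\in\mathbb{Q}[x]$, $\deg Q\le 3$, $\deg P\le 6$, such that $x$ generates the subfield of $\mathbb{Q}(C)$ fixed by the hyperelliptic involution and $\mathbb{Q}(C)=\mathbb{Q}(x)[y]$. Its discriminant is $\Delta_E=2^{-12}\operatorname{disc}(4P(x)+Q(x)^2)$. A Weierstrass equation is integral if $P,Q\in\mathbb{Z}[x]$; it is minimal at a prime $p$ if it is integral and the $p$-adic valuation of its discriminant is smallest among all integral Weierstrass equations describing $C$ over $\mathbb{Z}_p$; it is globally minimal if it is minimal at every prime. Weierstrass points of $C$ are the fixed points of the hyperelliptic involution; $\mathbb{Q}$-rational ones are those defined over $\mathbb{Q}$. *)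

theory Defs
  imports "HOL-Computational_Algebra.Computational_Algebra" "Subresultants.Resultant_Prelim"
begin

text \<open>Discriminant of a polynomial of exact degree d (classical normalisation
  lc^(2d-2) * prod_(i<j) (r_i - r_j)^2), via the resultant with the derivative.\<close>
definition poly_disc :: "rat poly \<Rightarrow> rat" where
  "poly_disc f = (let d = degree f in
     (-1) ^ (d * (d - 1) div 2) * resultant f (pderiv f) / lead_coeff f)"

text \<open>Discriminant of F viewed as a binary sextic (degree \<le> 6, possibly with
  roots at infinity): if a6 = 0 it equals a5^2 times the quintic discriminant,
  and it vanishes if a6 = a5 = 0.\<close>
definition disc6 :: "rat poly \<Rightarrow> rat" where
  "disc6 F = (if degree F = 6 then poly_disc F
              else if degree F = 5 then (coeff F 5)^2 * poly_disc F
              else 0)"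

definition weq_disc :: "rat poly \<Rightarrow> rat poly \<Rightarrow> rat" where
  "weq_disc P Q = disc6 (Polynomial.smult 4 P + Q^2) / 2^12"

definition is_weq :: "rat poly \<Rightarrow> rat poly \<Rightarrow> bool" where
  "is_weq P Q \<longleftrightarrow> degree P \<le> 6 \<and> degree Q \<le> 3 \<and> weq_disc P Q \<noteq> 0"

text \<open>(cx+d)^n f((ax+b)/(cx+d)) as a polynomial.\<close>
definition hom_subst :: "nat \<Rightarrow> rat poly \<Rightarrow> rat \<Rightarrow> rat \<Rightarrow> rat \<Rightarrow> rat \<Rightarrow> rat poly" where
  "hom_subst n f a b c d = (\<Sum>i\<le>n. Polynomial.smult (coeff f i) ([:b, a:] ^ i * [:d, c:] ^ (n - i)))"

text \<open>Two Weierstrass equations describe the same curve over Q: related by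
  x = (a x' + b)/(c x' + d), y = (e y' + H(x'))/(c x' + d)^3.\<close>
definition weq_iso :: "rat poly \<Rightarrow> rat poly \<Rightarrow> rat poly \<Rightarrow> rat poly \<Rightarrow> bool" where
  "weq_iso P Q P' Q' \<longleftrightarrow> (\<exists>a b c d e H. a * d - b * c \<noteq> 0 \<and> e \<noteq> 0 \<and> degree H \<le> 3 \<and>
      Polynomial.smult e Q' = hom_subst 3 Q a b c d + Polynomial.smult 2 H \<and>
      Polynomial.smult (e^2) P' = hom_subst 6 P a b c d - H^2 - H * hom_subst 3 Q a b c d)"

definition p_integral :: "nat \<Rightarrow> rat \<Rightarrow> bool" where
  "p_integral p r \<longleftrightarrow> \<not> (int p dvd snd (quotient_of r))"

definition p_integral_poly :: "nat \<Rightarrow> rat poly \<Rightarrow> bool" where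
  "p_integral_poly p f \<longleftrightarrow> (\<forall>i. p_integral p (coeff f i))"

text \<open>p-adic valuation of a rational number (value 0 at 0 is irrelevant here).\<close>
definition rat_pval :: "nat \<Rightarrow> rat \<Rightarrow> int" where
  "rat_pval p r = (if r = 0 then 0 else
     int (multiplicity (int p) (fst (quotient_of r))) - int (multiplicity (int p) (snd (quotient_of r))))"

definition int_poly :: "rat poly \<Rightarrow> bool" where
  "int_poly f \<longleftrightarrow> (\<forall>i. coeff f i \<in> \<int>)"

definition minimal_at :: "nat \<Rightarrow> rat poly \<Rightarrow> rat poly \<Rightarrow> bool" where
  "minimal_at p P Q \<longleftrightarrow> int_poly P \<and> int_poly Q \<and>
     (\<forall>P' Q'. is_weq P' Q' \<and> weq_iso P Q P' Q' \<and> p_integral_poly p P' \<and> p_integral_poly p Q'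
        \<longrightarrow> rat_pval p (weq_disc P Q) \<le> rat_pval p (weq_disc P' Q'))"

definition globally_minimal :: "rat poly \<Rightarrow> rat poly \<Rightarrow> bool" where
  "globally_minimal P Q \<longleftrightarrow> (\<forall>p::nat. prime p \<longrightarrow> minimal_at p P Q)"

text \<open>Q-rational Weierstrass points (fixed points of the hyperelliptic involution)
  on the smooth projective model: affine chart (x,y) with involution
  y -> -y - Q(x), and points at infinity (x' = 1/x = 0, Y = y/x^3) satisfying
  Y^2 + q3 Y = p6 with involution Y -> -Y - q3.\<close>
definition rat_weierstrass_points :: "rat poly \<Rightarrow> rat poly \<Rightarrow> ((rat \<times> rat) + rat) set" where
  "rat_weierstrass_points P Q =
     Inl ` {(x, y). y^2 + poly Q x * y = poly P x \<and> 2 * y + poly Q x = 0} \<union>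
     Inr ` {Y. Y^2 + coeff Q 3 * Y = coeff P 6 \<and> 2 * Y + coeff Q 3 = 0}"

end

theory Submission
  imports Defs
begin

text \<open>
  Completing the square gives an integral quintic \<open>F = 4P + Q^2\<close> with leading coefficient 4,
  whose discriminant is \<open>2^8\<close> times that of the equation, and the four rational Weierstrass points
  are infinity and three rational roots of \<open>F\<close>. Since \<open>F\<close> is a square modulo 4, each of these
  roots is an integer or of the form \<open>u/4\<close> with \<open>u\<close> odd, and at most one is not an integer.

  Suppose the discriminant is \<open>p\<close> up to sign. If \<open>u/4\<close>, \<open>m\<close>, \<open>n\<close> are the roots, the odd numbers
  \<open>u - 4m\<close> and \<open>u - 4n\<close> have squares dividing \<open>p\<close> times a power of 2, so both are \<open>1\<close> or \<open>-1\<close>,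
  which forces \<open>m = n\<close>. If the roots \<open>l < m < n\<close> are integers and \<open>q\<close> is the remaining quadratic
  factor, then \<open>(l - m)(l - n)(m - n) q(l) q(m) q(n)\<close> is \<open>16\<close> or \<open>-16\<close> when \<open>q\<close> has odd middle
  coefficient. So the roots are equally spaced with gap 1 or 2, and both gaps contradict the second
  difference of \<open>q\<close> together with the evenness of the cubic coefficient of \<open>F\<close>. If the middle
  coefficient of \<open>q\<close> is even, 4 divides \<open>q\<close> and the discriminant is even.
\<close>

section \<open>Discriminant of a quintic with three rational roots\<close>

text \<open>Unimodular row and column operations turn the Sylvester matrix of
  \<open>(x - a) h\<close> and \<open>g\<close> into that of \<open>h\<close> and \<open>g\<close>,
  bordered by a column whose only nonzero entry can be \<open>g(a)\<close>. Iteration evaluates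
  resultants at roots.\<close>

lemma resultant_linear_mult_left:
  fixes h g :: "'a :: idom poly"
  assumes "h \<noteq> 0"
  shows "resultant ([:- a, 1:] * h) g = poly g a * resultant h g"
proof -
  define f where "f = [:- a, 1:] * h"
  define n where "n = degree g"
  define N where "N = degree h + n"
  have deg_f: "degree f = Suc (degree h)"
    using assms unfolding f_def by (subst degree_mult_eq) auto
  \<comment> \<open>\<open>R i\<close> is row \<open>i\<close> of the Sylvester matrix of
    \<open>f\<close> and \<open>g\<close>, read as a polynomial with the highest coefficient first.
    \<open>W i\<close> and \<open>r i\<close> are the quotient and remainder of row \<open>i\<close>
    of \<open>U * S\<close> on division by \<open>x - a\<close>.\<close>
  define R where "R i = (if i < n then monom 1 (n - 1 - i) * f else monom 1 (N - i) * g)" for i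
  define W where "W i = (if i < n then monom 1 (n - 1 - i) * h
    else if i < N then monom 1 (N - 1 - i) * g else synthetic_div g a)" for i
  define r where "r i = (if i < N then 0 else poly g a)" for i
  define S where "S = sylvester_mat f g"
  define M where "M = four_block_mat (sylvester_mat h g) (0\<^sub>m N 1)
    (mat 1 N (\<lambda>(i, j). coeff (synthetic_div g a) (N - 1 - j))) (mat 1 1 (\<lambda>_. poly g a))"
  \<comment> \<open>\<open>U\<close> replaces the rows \<open>x^i g\<close> with \<open>i > 0\<close> by \<open>(x - a) x^(i-1) g\<close>; the rows of \<open>M\<close> are the resulting
    polynomials in the basis \<open>(x - a) x^k\<close>, \<open>1\<close>, and \<open>K\<close> converts that basis to the monomials.\<close>
  define U where "U = mat (Suc N) (Suc N)
    (\<lambda>(i, k). if k = i then 1 else if k = Suc i \<and> n \<le> i then - a else 0)"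
  define K where "K = mat (Suc N) (Suc N)
    (\<lambda>(k, j). if j = k then 1 else if j = Suc k then - a else 0)"
  have S: "S \<in> carrier_mat (Suc N) (Suc N)"
    unfolding S_def using sylvester_carrier_mat[of f g] deg_f by (simp add: N_def n_def)
  have hg: "sylvester_mat h g \<in> carrier_mat N N"
    using sylvester_carrier_mat[of h g] by (simp add: N_def n_def)
  have M: "M \<in> carrier_mat (Suc N) (Suc N)"
    unfolding M_def using four_block_carrier_mat[OF hg, of _ 1 1] by simp
  have U: "U \<in> carrier_mat (Suc N) (Suc N)" and K: "K \<in> carrier_mat (Suc N) (Suc N)"
    unfolding U_def K_def by simp_all
  have S_ij: "S $$ (i, j) = coeff (R i) (N - j)" if "i \<le> N" "j \<le> N" for i j
  proof -
    have "i < degree f + degree g" "j < degree f + degree g"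
      using that deg_f by (simp_all add: N_def n_def)
    from sylvester_index_mat2[OF this] show ?thesis
      using that unfolding S_def R_def deg_f
      by (auto simp: coeff_monom_mult N_def n_def split: if_splits)
  qed
  have M_ij: "M $$ (i, j) = coeff (W i) (N - 1 - j)" if "i \<le> N" "j < N" for i j
  proof (cases "i < N")
    case True
    then have "i < degree h + degree g" "j < degree h + degree g"
      using that by (simp_all add: N_def n_def)
    from sylvester_index_mat2[OF this] True hg show ?thesis
      using that unfolding M_def W_def
      by (auto simp: coeff_monom_mult N_def n_def split: if_splits)
  next
    case False
    then show ?thesis using that hg unfolding M_def W_def by (auto simp: N_def)
  qed
  have M_iN: "M $$ (i, N) = r i" if "i \<le> N" for i
    using that hg unfolding M_def r_def by auto
  \<comment> \<open>Column 0 has no left neighbour under the shift in \<open>K\<close>, so the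
    coefficient of \<open>x^N\<close> must vanish. Constant \<open>g\<close> is separate:
    \<open>degree g - 1\<close> truncates to 0, which may equal \<open>N\<close>.\<close>
  have deg_W: "coeff (W i) N = 0" if "i \<le> N" for i
  proof -
    have "coeff (synthetic_div g a) N = 0"
    proof (cases "degree g = 0")
      case True
      then show ?thesis by (simp add: synthetic_div_eq_0_iff[THEN iffD2])
    next
      case False
      then show ?thesis by (intro coeff_eq_0) (auto simp: degree_synthetic_div N_def n_def)
    qed
    then show ?thesis
      using that unfolding W_def
      by (auto simp: coeff_monom_mult N_def n_def intro!: coeff_eq_0)
  qed
  have row: "R i - (if n \<le> i \<and> i < N then Polynomial.smult a (R (Suc i)) else 0) = [:- a, 1:] * W i + [:r i:]"
    if "i \<le> N" for i
  proof -
    consider "i < n" | "n \<le> i" "i < N" | "i = N" "n \<le> i"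
      using \<open>i \<le> N\<close> by linarith
    then show ?thesis
    proof cases
      case 1
      then show ?thesis by (simp add: R_def W_def r_def f_def N_def algebra_simps)
    next
      case 2
      then have "N - i = Suc (N - 1 - i)" by simp
      with 2 show ?thesis
        by (simp add: R_def W_def r_def monom_Suc algebra_simps)
    next
      case 3
      then show ?thesis
        using synthetic_div_correct'[of a g] by (simp add: R_def W_def r_def algebra_simps)
    qed
  qed
  have "U * S = M * K"
  proof (rule eq_matI)
    fix i j assume "i < dim_row (M * K)" "j < dim_col (M * K)"
    then have ij: "i \<le> N" "j \<le> N" using M K by auto
    have "(U * S) $$ (i, j) = (\<Sum>k<Suc N. U $$ (i, k) * S $$ (k, j))"
      using ij U S by (auto simp: scalar_prod_def lessThan_atLeast0)
    also have "\<dots> = (\<Sum>k<Suc N. (if k = i then S $$ (i, j) else 0) +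
        (if k = Suc i then if n \<le> i then - a * S $$ (Suc i, j) else 0 else 0))"
      using ij by (intro sum.cong) (auto simp: U_def)
    also have "\<dots> = S $$ (i, j) + (if n \<le> i \<and> i < N then - a * S $$ (Suc i, j) else 0)"
      using ij by (subst sum.distrib, subst (1 2) sum.delta) auto
    also have "\<dots> = coeff (R i - (if n \<le> i \<and> i < N then Polynomial.smult a (R (Suc i)) else 0)) (N - j)"
      using ij by (auto simp: S_ij)
    also have "\<dots> = coeff ([:- a, 1:] * W i + [:r i:]) (N - j)"
      using row[OF ij(1)] by simp
    also have "\<dots> = M $$ (i, j) + (if 0 < j then - a * M $$ (i, j - 1) else 0)"
    proof -
      have "coeff (pCons (r i) (W i)) (N - j) = M $$ (i, j)"
      proof (cases "j = N")
        case False
        then have "N - j = Suc (N - 1 - j)" using ij by simp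
        then show ?thesis using False ij by (simp add: M_ij)
      qed (simp add: M_iN[OF ij(1)])
      moreover have "coeff (W i) (N - j) = (if 0 < j then M $$ (i, j - 1) else 0)"
        using ij M_ij[OF ij(1), of "j - 1"] deg_W[OF ij(1)] by (cases "j = 0") auto
      moreover have "[:- a, 1:] * W i + [:r i:] = pCons (r i) (W i) - Polynomial.smult a (W i)"
        by (simp add: algebra_simps)
      ultimately show ?thesis by (simp only: coeff_diff coeff_smult) simp
    qed
    also have "\<dots> = (\<Sum>k<Suc N. (if k = j then M $$ (i, j) else 0) +
        (if k = j - 1 then if 0 < j then - a * M $$ (i, j - 1) else 0 else 0))"
      using ij by (subst sum.distrib, subst (1 2) sum.delta) auto
    also have "\<dots> = (\<Sum>k<Suc N. M $$ (i, k) * K $$ (k, j))"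
      using ij by (intro sum.cong) (auto simp: K_def)
    also have "\<dots> = (M * K) $$ (i, j)"
      using ij M K by (auto simp: scalar_prod_def lessThan_atLeast0)
    finally show "(U * S) $$ (i, j) = (M * K) $$ (i, j)" .
  qed (use U S M K in auto)
  then have "det U * det S = det M * det K"
    using det_mult[OF U S] det_mult[OF M K] by simp
  moreover have "det U = 1"
    using U by (subst det_upper_triangular[OF _ U])
      (auto simp: upper_triangular_def U_def prod_list_diag_prod)
  moreover have "det K = 1"
    using K by (subst det_upper_triangular[OF _ K])
      (auto simp: upper_triangular_def K_def prod_list_diag_prod)
  moreover have "det M = det (sylvester_mat h g) * poly g a"
    unfolding M_def using hg
    by (subst det_four_block_mat_upper_right_zero_col[OF hg]) (auto simp: det_single)
  ultimately show ?thesis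
    unfolding resultant_def S_def f_def by simp
qed

text \<open>Over the complex numbers \<open>q\<close> splits too, so the resultant is a product over
  ordered pairs of five roots. The pairs inside \<open>q\<close> give its discriminant, the mixed
  pairs the values of \<open>q\<close>.\<close>

lemma resultant_pderiv_three_roots_complex:
  fixes l m n e b c :: complex
  assumes "e \<noteq> 0"
  defines "q \<equiv> [:c, b, e:]"
  defines "F \<equiv> [:- l, 1:] * [:- m, 1:] * [:- n, 1:] * q"
  shows "resultant F (pderiv F) =
    e * ((l - m) * (l - n) * (m - n))\<^sup>2 * (b\<^sup>2 - 4 * e * c) * (poly q l * poly q m * poly q n)\<^sup>2"
proof -
  \<comment> \<open>Each of the ten differences occurs with both signs, so the signs cancel. Of the
    nine factors \<open>e\<close>, two go to the discriminant of \<open>q\<close> and six to its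
    values.\<close>
  have *: "(e * a1 * a2 * a3 * a4) * (e * - a1 * b2 * b3 * b4) * (e * - a2 * - b2 * c3 * c4) *
      (e * - a3 * - b3 * - c3 * d4) * (e * - a4 * - b4 * - c4 * - d4) * e ^ 4 =
      e * (a1 * a2 * b2)\<^sup>2 * (e * d4)\<^sup>2 * (e * a3 * a4 * (e * b3 * b4) * (e * c3 * c4))\<^sup>2"
    for a1 a2 a3 a4 b2 b3 b4 c3 c4 d4 :: complex
    by (simp add: power2_eq_square power4_eq_xxxx mult_ac)
  define d where "d = csqrt (b\<^sup>2 - 4 * e * c)"
  define r s where "r = (- b + d) / (2 * e)" and "s = (- b - d) / (2 * e)"
  have d2: "d\<^sup>2 = b\<^sup>2 - 4 * e * c" by (simp add: d_def)
  have b: "b = - e * (r + s)" using assms(1) by (simp add: r_def s_def field_simps)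
  have "4 * e\<^sup>2 * (r * s) = b\<^sup>2 - d\<^sup>2"
    using assms(1) by (simp add: r_def s_def power2_eq_square field_simps)
  then have c: "c = e * r * s"
    using assms(1) unfolding d2 by (simp add: power2_eq_square mult.assoc)
  have q: "q = [:- r, 1:] * ([:- s, 1:] * [:e:])"
    unfolding q_def b c by (simp add: algebra_simps)
  have F: "F = [:- l, 1:] * ([:- m, 1:] * ([:- n, 1:] * ([:- r, 1:] * ([:- s, 1:] * [:e:]))))"
    unfolding F_def q by (simp only: mult.assoc)
  have "degree F = 5"
    unfolding F using assms(1) by (simp add: degree_mult_eq)
  then have deg: "degree (pderiv F) = 4" by (simp add: degree_pderiv)
  \<comment> \<open>Splitting off five roots leaves the constant \<open>e\<close>, whose resultant
    with a derivative of degree 4 is \<open>e ^ 4\<close>.\<close>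
  have "resultant F (pderiv F) = poly (pderiv F) l * poly (pderiv F) m * poly (pderiv F) n *
      poly (pderiv F) r * poly (pderiv F) s * e ^ 4"
    by (subst (1) F) (simp add: resultant_linear_mult_left assms(1) deg del: mult_pCons_left mult_pCons_right)
  \<comment> \<open>At a root only the product rule term that differentiates its own linear factor
    survives.\<close>
  also have "\<dots> = (e * (l - m) * (l - n) * (l - r) * (l - s)) * (e * (m - l) * (m - n) * (m - r) * (m - s)) *
     (e * (n - l) * (n - m) * (n - r) * (n - s)) * (e * (r - l) * (r - m) * (r - n) * (r - s)) *
     (e * (s - l) * (s - m) * (s - n) * (s - r)) * e ^ 4"
    by (simp add: F pderiv_mult pderiv_pCons del: mult_pCons_left mult_pCons_right)
  also have "\<dots> = e * ((l - m) * (l - n) * (m - n))\<^sup>2 * (e * (r - s))\<^sup>2 *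
     (e * (l - r) * (l - s) * (e * (m - r) * (m - s)) * (e * (n - r) * (n - s)))\<^sup>2"
    using *[of "l - m" "l - n" "l - r" "l - s" "m - n" "m - r" "m - s" "n - r" "n - s" "r - s"]
    by (simp only: minus_diff_eq)
  also have "(e * (r - s))\<^sup>2 = b\<^sup>2 - 4 * e * c" unfolding b c by Groebner_Basis.algebra
  finally show ?thesis by (simp add: q algebra_simps)
qed


text \<open>Resultants commute with the embedding of the rationals into the complex numbers.\<close>

lemma resultant_pderiv_three_roots:
  fixes l m n e b c :: rat
  assumes "e \<noteq> 0"
  defines "q \<equiv> [:c, b, e:]"
  defines "F \<equiv> [:- l, 1:] * [:- m, 1:] * [:- n, 1:] * q"
  shows "resultant F (pderiv F) =
    e * ((l - m) * (l - n) * (m - n))\<^sup>2 * (b\<^sup>2 - 4 * e * c) * (poly q l * poly q m * poly q n)\<^sup>2"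
proof -
  interpret poly_hom: map_poly_idom_hom "of_rat :: rat \<Rightarrow> complex" ..
  let ?h = "map_poly (of_rat :: rat \<Rightarrow> complex)"
  have "complex_of_rat (resultant F (pderiv F)) = resultant (?h F) (pderiv (?h F))"
    by (simp add: of_rat_hom.resultant_hom flip: of_rat_hom.map_poly_pderiv)
  also have "?h F = [:- of_rat l, 1:] * [:- of_rat m, 1:] * [:- of_rat n, 1:] * [:of_rat c, of_rat b, of_rat e:]"
    unfolding F_def q_def
    by (simp add: poly_hom.hom_mult of_rat_hom.map_poly_pCons_hom of_rat_minus
        del: mult_pCons_left mult_pCons_right)
  also have "resultant \<dots> (pderiv \<dots>) = of_rat (e * ((l - m) * (l - n) * (m - n))\<^sup>2 * (b\<^sup>2 - 4 * e * c) *
      (poly q l * poly q m * poly q n)\<^sup>2)"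
    using assms(1) by (subst resultant_pderiv_three_roots_complex)
      (simp_all add: q_def of_rat_mult of_rat_diff of_rat_power of_rat_add)
  finally show ?thesis by (simp only: of_rat_eq_iff)
qed

text \<open>Comparing the two coefficients below the leading one forces \<open>b\<close> and
  \<open>c\<close>. The difference of both sides is then \<open>r2 x^2 + r1 x + r0\<close>, which
  vanishes at three distinct points. The explicit \<open>b\<close> and \<open>c\<close> are what the
  later parity arguments use.\<close>

lemma quintic_with_three_roots:
  fixes l m n e f0 f1 f2 f3 f4 :: "'a :: idom"
  defines "F \<equiv> [:f0, f1, f2, f3, f4, e:]"
  defines "b \<equiv> f4 + e * (l + m + n)"
  defines "c \<equiv> f3 + b * (l + m + n) - e * (l * m + l * n + m * n)"
  assumes roots: "poly F l = 0" "poly F m = 0" "poly F n = 0"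
    and distinct: "l \<noteq> m" "l \<noteq> n" "m \<noteq> n"
  shows "F = [:- l, 1:] * [:- m, 1:] * [:- n, 1:] * [:c, b, e:]"
proof -
  define s1 s2 s3 where s: "s1 = l + m + n" "s2 = l * m + l * n + m * n" "s3 = l * m * n"
  define r2 r1 r0 where r: "r2 = f2 + c * s1 - b * s2 + e * s3"
    "r1 = f1 - c * s2 + b * s3" "r0 = f0 + c * s3"
  have R: "r2 * l\<^sup>2 + r1 * l + r0 = 0" "r2 * m\<^sup>2 + r1 * m + r0 = 0" "r2 * n\<^sup>2 + r1 * n + r0 = 0"
    using roots unfolding F_def r s b_def c_def by (simp_all, Groebner_Basis.algebra+)
  have "(l - m) * (r2 * (l + m) + r1) = 0" "(l - n) * (r2 * (l + n) + r1) = 0"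
    using R by Groebner_Basis.algebra+
  then have *: "r2 * (l + m) + r1 = 0" "r2 * (l + n) + r1 = 0"
    using distinct by auto
  then have "r2 * (m - n) = 0" by Groebner_Basis.algebra
  then have "r2 = 0" using distinct by auto
  with * R have "r2 = 0" "r1 = 0" "r0 = 0" by auto
  then have "f2 = b * s2 - c * s1 - e * s3" "f1 = c * s2 - b * s3" "f0 = - c * s3"
    unfolding r by Groebner_Basis.algebra+
  then show ?thesis
    unfolding F_def s by (simp add: b_def c_def algebra_simps)
qed

section \<open>Rational roots of quintics that are squares modulo 4\<close>

text \<open>The denominator divides the leading coefficient 4, and parity rules out 2. The
  conditions on \<open>f4\<close> and \<open>f3\<close> hold for \<open>4P + Q^2\<close> with
  \<open>deg Q \<le> 2\<close>.\<close>

lemma rational_root_integer_or_odd_quarter: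
  fixes f0 f1 f2 f3 f4 :: int and x :: rat
  assumes root: "poly (map_poly of_int [:f0, f1, f2, f3, f4, 4:]) x = 0"
    and f4: "even f4 \<Longrightarrow> 4 dvd f4" and f3: "even f3"
  shows "x \<in> \<int> \<or> (\<exists>u. odd u \<and> x = of_int u / 4)"
proof -
  obtain s t where x: "x = of_int s / of_int t" and t: "t > 0" and st: "coprime s t"
    by (metis Fract_of_int_quotient Rat_cases)
  have "4 * x ^ 5 + of_int f4 * x ^ 4 + of_int f3 * x ^ 3 + of_int f2 * x ^ 2 + of_int f1 * x + of_int f0 = 0"
    using root by (simp add: map_poly_pCons algebra_simps power_numeral_reduce)
  then have "4 * of_int s ^ 5 + of_int f4 * of_int s ^ 4 * of_int t + of_int f3 * of_int s ^ 3 * of_int t ^ 2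
     + of_int f2 * of_int s ^ 2 * of_int t ^ 3 + of_int f1 * of_int s * of_int t ^ 4 + of_int f0 * of_int t ^ 5 = (0 :: rat)"
    unfolding x using t by (simp add: field_simps power_numeral_reduce)
  then have "of_int (4 * s ^ 5 + f4 * s ^ 4 * t + f3 * s ^ 3 * t ^ 2
     + f2 * s ^ 2 * t ^ 3 + f1 * s * t ^ 4 + f0 * t ^ 5) = (0 :: rat)"
    by simp
  then have eq: "4 * s ^ 5 + f4 * s ^ 4 * t + f3 * s ^ 3 * t ^ 2
     + f2 * s ^ 2 * t ^ 3 + f1 * s * t ^ 4 + f0 * t ^ 5 = 0"
    by (simp only: of_int_eq_0_iff)
  then have "4 * s ^ 5 = t * - (f4 * s ^ 4 + f3 * s ^ 3 * t + f2 * s ^ 2 * t ^ 2 + f1 * s * t ^ 3 + f0 * t ^ 4)"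
    by Groebner_Basis.algebra
  then have "t dvd 4 * s ^ 5" by (metis dvd_triv_left)
  then have "t dvd 4"
    using st by (simp add: coprime_dvd_mult_left_iff coprime_commute)
  then have "t = 1 \<or> t = 2 \<or> t = 4"
  proof -
    have "t \<le> 4" using \<open>t dvd 4\<close> by (auto dest: zdvd_imp_le)
    then have "t \<in> {1, 2, 3, 4}" using t by auto
    then show ?thesis using \<open>t dvd 4\<close> by auto
  qed
  moreover have "t \<noteq> 2"
  proof
    assume t2: "t = 2"
    then have "odd s" using st by (simp add: coprime_commute)
    \<comment> \<open>Reduction modulo 2 makes \<open>f4\<close> even, hence divisible by 4; a
      further division by 2 then makes \<open>s ^ 5\<close> even.\<close>
    have *: "2 * s ^ 5 + f4 * s ^ 4 + 2 * (f3 * s ^ 3) + 4 * (f2 * s ^ 2 + 2 * f1 * s + 4 * f0) = 0"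
      using eq unfolding t2 by simp
    then have "f4 * s ^ 4 = 2 * - (s ^ 5 + f3 * s ^ 3 + 2 * (f2 * s ^ 2 + 2 * f1 * s + 4 * f0))"
      by Groebner_Basis.algebra
    then have "even (f4 * s ^ 4)" by (metis dvd_triv_left)
    then have "even f4" using \<open>odd s\<close> by simp
    then obtain g4 where g4: "f4 = 4 * g4" using f4 by blast
    obtain g3 where g3: "f3 = 2 * g3" using f3 by blast
    have "s ^ 5 = 2 * - (g4 * s ^ 4 + g3 * s ^ 3 + f2 * s ^ 2 + 2 * f1 * s + 4 * f0)"
      using * unfolding g3 g4 by Groebner_Basis.algebra
    then have "even (s ^ 5)" by (metis dvd_triv_left)
    then show False using \<open>odd s\<close> by simp
  qed
  moreover have "odd s" if "t = 4"
  proof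
    assume "even s"
    moreover have "even t" using that by simp
    ultimately show False using st by (meson coprime_common_divisor odd_one)
  qed
  ultimately show ?thesis using x by auto
qed

text \<open>Multiplying by 256 gives a monic integral quintic for \<open>w = 4x\<close>. Its divided
  difference at two odd points is odd: five odd monomials, an even multiple of \<open>f4\<close>,
  and even terms.\<close>

lemma odd_quarter_root_unique:
  fixes f0 f1 f2 f3 f4 u v :: int
  assumes root: "poly (map_poly of_int [:f0, f1, f2, f3, f4, 4:]) (of_int u / 4 :: rat) = 0"
      "poly (map_poly of_int [:f0, f1, f2, f3, f4, 4:]) (of_int v / 4 :: rat) = 0"
    and odd: "odd u" "odd v"
  shows "u = v"
proof (rule ccontr)
  assume "u \<noteq> v"
  have scaled: "w ^ 5 + f4 * w ^ 4 + 4 * f3 * w ^ 3 + 16 * f2 * w ^ 2 + 64 * f1 * w + 256 * f0 = 0"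
    if "poly (map_poly of_int [:f0, f1, f2, f3, f4, 4:]) (of_int w / 4 :: rat) = 0" for w
  proof -
    have "of_int (w ^ 5 + f4 * w ^ 4 + 4 * f3 * w ^ 3 + 16 * f2 * w ^ 2 + 64 * f1 * w + 256 * f0) = (0 :: rat)"
      using that by (simp add: map_poly_pCons field_simps power_numeral_reduce)
    then show ?thesis by (simp only: of_int_eq_0_iff)
  qed
  have "(u - v) * (u ^ 4 + u ^ 3 * v + u ^ 2 * v ^ 2 + u * v ^ 3 + v ^ 4 +
      f4 * (u ^ 3 + u ^ 2 * v + u * v ^ 2 + v ^ 3) + 4 * f3 * (u ^ 2 + u * v + v ^ 2) +
      16 * f2 * (u + v) + 64 * f1) = 0"
    using scaled[OF root(1)] scaled[OF root(2)] by Groebner_Basis.algebra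
  then have "u ^ 4 + u ^ 3 * v + u ^ 2 * v ^ 2 + u * v ^ 3 + v ^ 4 +
      f4 * (u ^ 3 + u ^ 2 * v + u * v ^ 2 + v ^ 3) + 4 * f3 * (u ^ 2 + u * v + v ^ 2) +
      16 * f2 * (u + v) + 64 * f1 = 0"
    using \<open>u \<noteq> v\<close> by simp
  moreover have "odd (u ^ 4 + u ^ 3 * v + u ^ 2 * v ^ 2 + u * v ^ 3 + v ^ 4 +
      f4 * (u ^ 3 + u ^ 2 * v + u * v ^ 2 + v ^ 3) + 4 * f3 * (u ^ 2 + u * v + v ^ 2) +
      16 * f2 * (u + v) + 64 * f1)"
    using odd by simp
  ultimately show False by (metis dvd_0_right)
qed

section \<open>Arithmetic of the discriminant\<close>

lemma abs_eq_1_if_square_dvd_prime: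
  fixes k p :: int
  assumes "k\<^sup>2 dvd p" "prime p"
  shows "\<bar>k\<bar> = 1"
proof -
  have "is_unit k"
    using assms squarefreeD[OF squarefree_prime] by blast
  then show ?thesis by auto
qed

lemma odd_abs_eq_1_if_square_dvd:
  fixes k p :: int
  assumes "k\<^sup>2 dvd 2 ^ j * p" "prime p" "odd k"
  shows "\<bar>k\<bar> = 1"
proof -
  have "coprime (k\<^sup>2) (2 ^ j)" using \<open>odd k\<close> by simp
  then have "k\<^sup>2 dvd p" using assms(1) by (simp add: coprime_dvd_mult_right_iff)
  then show ?thesis using assms(2) by (rule abs_eq_1_if_square_dvd_prime)
qed

text \<open>With a root \<open>u/4\<close>, the constant coefficient of the quadratic cofactor is
  only a quarter of an integer, hence \<open>c / 4\<close>.\<close>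

lemma no_prime_discriminant_two_integral_roots:
  fixes m n u b c p :: int
  defines "q \<equiv> \<lambda>x :: rat. 4 * x\<^sup>2 + of_int b * x + of_int c / 4"
  assumes "odd u" "m \<noteq> n" "prime p"
    and D: "\<bar>((of_int u / 4 - of_int m) * (of_int u / 4 - of_int n) * (of_int m - of_int n))\<^sup>2 *
      (of_int b ^ 2 - 4 * of_int c) * (q (of_int u / 4) * q (of_int m) * q (of_int n))\<^sup>2\<bar> = 2 ^ 8 * of_int p"
  shows False
proof -
  define k where "k = (m - n)\<^sup>2 * (b\<^sup>2 - 4 * c) *
    ((u\<^sup>2 + b * u + c) * (16 * m\<^sup>2 + 4 * b * m + c) * (16 * n\<^sup>2 + 4 * b * n + c))\<^sup>2"
  \<comment> \<open>Clearing denominators costs \<open>4^4\<close> for the two differences and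
    \<open>4^6\<close> for the three values of \<open>q\<close>, in total
    \<open>2^20\<close>.\<close>
  have *: "(4 * X)\<^sup>2 * (4 * Y)\<^sup>2 * (Z\<^sup>2 * B * (4 * q1 * (4 * q2) * (4 * q3))\<^sup>2) =
      2 ^ 20 * ((X * Y * Z)\<^sup>2 * B * (q1 * q2 * q3)\<^sup>2)" for X Y Z B q1 q2 q3 :: rat
    by (simp add: power_mult_distrib)
  have q: "of_int (16 * m\<^sup>2 + 4 * b * m + c) = 4 * q (of_int m)"
    "of_int (16 * n\<^sup>2 + 4 * b * n + c) = 4 * q (of_int n)"
    "of_int (u\<^sup>2 + b * u + c) = 4 * q (of_int u / 4)"
    "of_int (u - 4 * m) = 4 * (of_int u / 4 - of_int m :: rat)"
    "of_int (u - 4 * n) = 4 * (of_int u / 4 - of_int n :: rat)"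
    by (simp_all add: q_def field_simps power2_eq_square)
  have "of_int ((u - 4 * m)\<^sup>2 * (u - 4 * n)\<^sup>2 * k) = 2 ^ 20 * (((of_int u / 4 - of_int m) * (of_int u / 4 - of_int n) *
      (of_int m - of_int n))\<^sup>2 * (of_int b ^ 2 - 4 * of_int c) * (q (of_int u / 4) * q (of_int m) * q (of_int n))\<^sup>2)"
    unfolding k_def of_int_mult of_int_power q *[symmetric] by simp
  then have "\<bar>of_int ((u - 4 * m)\<^sup>2 * (u - 4 * n)\<^sup>2 * k) :: rat\<bar> = 2 ^ 20 * (2 ^ 8 * of_int p)"
    using D by (simp only: abs_mult[of "2 ^ 20"]) simp
  then have "(of_int \<bar>(u - 4 * m)\<^sup>2 * (u - 4 * n)\<^sup>2 * k\<bar> :: rat) = of_int (2 ^ 28 * p)"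
    by simp
  then have eq: "\<bar>(u - 4 * m)\<^sup>2 * (u - 4 * n)\<^sup>2 * k\<bar> = 2 ^ 28 * p"
    by (simp only: of_int_eq_iff)
  have "(u - 4 * m)\<^sup>2 dvd 2 ^ 28 * p" "(u - 4 * n)\<^sup>2 dvd 2 ^ 28 * p"
    unfolding eq[symmetric] by simp_all
  then have "\<bar>u - 4 * m\<bar> = 1" "\<bar>u - 4 * n\<bar> = 1"
    using odd_abs_eq_1_if_square_dvd[of _ 28 p] \<open>prime p\<close> \<open>odd u\<close> by auto
  \<comment> \<open>Two numbers from \<open>{1, -1}\<close> that differ by a multiple of 4 are
    equal.\<close>
  then show False using \<open>m \<noteq> n\<close> by presburger
qed

text \<open>Here \<open>x\<close> and \<open>y\<close> stand for the gaps between consecutive roots.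
  A gap of at least 4 makes the product at least 20, so finitely many pairs remain.\<close>

lemma gaps_of_product_dvd_16:
  fixes x y :: int
  assumes "0 < x" "0 < y" "x * y * (x + y) dvd 16"
  shows "x = y \<and> (x = 1 \<or> x = 2)"
proof -
  have le: "x * y * (x + y) \<le> 16" using assms by (auto dest: zdvd_imp_le)
  have "x < 4"
  proof (rule ccontr)
    assume "\<not> x < 4"
    then have "4 * 1 * (4 + 1) \<le> x * y * (x + y)" using assms by (intro mult_mono) auto
    then show False using le by simp
  qed
  moreover have "y < 4"
  proof (rule ccontr)
    assume "\<not> y < 4"
    then have "1 * 4 * (1 + 4) \<le> x * y * (x + y)" using assms by (intro mult_mono) auto
    then show False using le by simp
  qed
  ultimately have "x \<in> {1, 2, 3}" "y \<in> {1, 2, 3}" using assms by auto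
  then show ?thesis using assms(3) by auto
qed

lemma abs_eq_1_if_odd_dvd_power2:
  fixes k :: int
  assumes "k dvd 2 ^ j" "odd k"
  shows "\<bar>k\<bar> = 1"
proof -
  have "coprime k (2 ^ j)" using assms(2) by simp
  then have "is_unit k" using assms(1) by (meson coprime_common_divisor dvd_refl)
  then show ?thesis by simp
qed

lemma no_prime_discriminant_three_integral_roots:
  fixes l m n b c f3 f4 p :: int
  defines "q \<equiv> \<lambda>x. 4 * x\<^sup>2 + b * x + c"
  assumes b: "b = f4 + 4 * (l + m + n)"
    and c: "c = f3 + b * (l + m + n) - 4 * (l * m + l * n + m * n)"
    and f4: "even f4 \<Longrightarrow> 4 dvd f4 \<and> 4 dvd f3" and f3: "even f3"
    and lmn: "l < m" "m < n" and p: "prime p" "odd p"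
    and D: "\<bar>((l - m) * (l - n) * (m - n))\<^sup>2 * (b\<^sup>2 - 16 * c) * (q l * q m * q n)\<^sup>2\<bar> = 2 ^ 8 * p"
  shows False
proof (cases "even f4")
  case True
  then have "4 dvd b" "4 dvd c" using f4 unfolding b c by auto
  \<comment> \<open>The three values put \<open>2^12\<close> into the square, \<open>2^4\<close>
    more than \<open>2^8 * p\<close> allows for odd \<open>p\<close>.\<close>
  then have "4 dvd q x" for x unfolding q_def by simp
  then have "4 * 4 * 4 dvd q l * q m * q n" by (intro mult_dvd_mono)
  then have "(4 * 4 * 4)\<^sup>2 dvd (q l * q m * q n)\<^sup>2" by (simp only: dvd_power_same)
  then have "(4 * 4 * 4)\<^sup>2 dvd 2 ^ 8 * p" unfolding D[symmetric] by simp
  then have "2 ^ 8 * 2 ^ 4 dvd 2 ^ 8 * p" by simp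
  then have "2 ^ 4 dvd p" by (subst (asm) dvd_mult_cancel_left) simp
  then show False using p(2) by (auto elim!: dvdE)
next
  case False
  then have "odd b" unfolding b by simp
  \<comment> \<open>Up to sign, \<open>N\<close> is the root of the square part of \<open>D\<close>,
    written with positive gaps. As \<open>b^2 - 16c\<close> is odd, all of \<open>2^8\<close> lies
    in \<open>N^2\<close>, and \<open>p\<close> being squarefree leaves
    \<open>\<bar>N\<bar> = 16\<close>.\<close>
  define N where "N = (m - l) * (n - m) * ((m - l) + (n - m)) * (q l * q m * q n)"
  have N2: "N\<^sup>2 * \<bar>b\<^sup>2 - 16 * c\<bar> = 2 ^ 8 * p"
  proof -
    have "N = - ((l - m) * (l - n) * (m - n) * (q l * q m * q n))"
      unfolding N_def by Groebner_Basis.algebra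
    then show ?thesis
      unfolding D[symmetric] by (simp add: abs_mult power_mult_distrib)
  qed
  have "(2 ^ 4)\<^sup>2 dvd N\<^sup>2 * \<bar>b\<^sup>2 - 16 * c\<bar>" unfolding N2 by simp
  moreover have "coprime ((2 ^ 4)\<^sup>2) \<bar>b\<^sup>2 - 16 * c\<bar>" 
  proof -
    have "coprime 2 \<bar>b\<^sup>2 - 16 * c\<bar>" using \<open>odd b\<close> by simp
    then show ?thesis by (simp only: coprime_power_left_iff simp_thms)
  qed
  ultimately have "(2 ^ 4)\<^sup>2 dvd N\<^sup>2" by (simp add: coprime_dvd_mult_left_iff)
  then have "2 ^ 4 dvd N" by (subst (asm) pow_divides_pow_iff) auto
  then obtain k where k: "N = 2 ^ 4 * k" by blast
  have "k\<^sup>2 * \<bar>b\<^sup>2 - 16 * c\<bar> = p" using N2 unfolding k by (simp add: power_mult_distrib)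
  then have "\<bar>k\<bar> = 1" using p(1) by (metis abs_eq_1_if_square_dvd_prime dvd_triv_left)
  then have N: "\<bar>N\<bar> = 16" unfolding k by (simp add: abs_mult)
  then have "N dvd 16" by (metis abs_dvd_iff dvd_refl)
  then have "(m - l) * (n - m) * ((m - l) + (n - m)) dvd 16"
    unfolding N_def using dvd_mult_left by blast
  with lmn have gaps: "m - l = n - m" "m - l = 1 \<or> m - l = 2"
    using gaps_of_product_dvd_16[of "m - l" "n - m"] by auto
  define h where "h = m - l"
  have ln: "l = m - h" "n = m + h" using gaps by (simp_all add: h_def)
  have second_diff: "q l + q n - 2 * q m = 8 * h\<^sup>2"
    unfolding q_def ln by (simp add: power2_eq_square algebra_simps)
  have absN: "2 * h ^ 3 * (\<bar>q l\<bar> * \<bar>q m\<bar> * \<bar>q n\<bar>) = 16"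
  proof -
    have "N = 2 * h ^ 3 * (q l * q m * q n)"
      unfolding N_def gaps(1)[symmetric] h_def[symmetric] by (simp add: power3_eq_cube)
    moreover have "0 < h" using lmn by (simp add: h_def)
    ultimately show ?thesis using N by (simp add: abs_mult)
  qed
  from gaps(2) show False
  proof
    assume "m - l = 1"
    then have h: "h = 1" by (simp add: h_def)
    have q8: "\<bar>q l\<bar> * \<bar>q m\<bar> * \<bar>q n\<bar> = 2 ^ 3" using absN h by simp
    \<comment> \<open>Since \<open>f3\<close> is even, \<open>b\<close> odd and
      \<open>l + m + n = 3m\<close>, \<open>c\<close> has the parity of \<open>m\<close>; so
      \<open>q\<close> is odd at the neighbours of \<open>m\<close>. Then \<open>q m\<close> is 8 or
      -8, too large for a second difference of 8.\<close>
    have "odd (q l)" "odd (q n)"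
      using \<open>odd b\<close> f3 unfolding q_def ln h c by auto
    moreover have "q l dvd 2 ^ 3" "q n dvd 2 ^ 3"
      unfolding q8[symmetric] by simp_all
    ultimately have "\<bar>q l\<bar> = 1" "\<bar>q n\<bar> = 1"
      using abs_eq_1_if_odd_dvd_power2 by blast+
    with q8 second_diff h show False by auto
  next
    assume "m - l = 2"
    then have h: "h = 2" by (simp add: h_def)
    have "\<bar>q l\<bar> * \<bar>q m\<bar> * \<bar>q n\<bar> = 1" using absN h by simp
    then have "\<bar>q l * q m * q n\<bar> = 1" by (simp add: abs_mult)
    \<comment> \<open>Three units have second difference at most 4 in absolute value, but
      \<open>8 * h^2 = 32\<close>.\<close>
    then have "\<bar>q l\<bar> = 1" "\<bar>q m\<bar> = 1" "\<bar>q n\<bar> = 1"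
      by (auto simp: abs_mult zmult_eq_1_iff)
    with second_diff h show False by auto
  qed
qed

section \<open>Rational Weierstrass points\<close>

text \<open>A fixed affine point has \<open>y = - Q(x) / 2\<close>, which turns the equation into
  \<open>4P + Q^2 = 0\<close>. The chart at infinity adds the single point
  \<open>Y = 0\<close>.\<close>

lemma card_rat_weierstrass_points:
  assumes "coeff P 6 = 0" "coeff Q 3 = 0" "Polynomial.smult 4 P + Q\<^sup>2 \<noteq> 0"
  shows "card (rat_weierstrass_points P Q) = Suc (card {x. poly (Polynomial.smult 4 P + Q\<^sup>2) x = 0})"
proof -
  define R where "R = {x. poly (Polynomial.smult 4 P + Q\<^sup>2) x = 0}"
  define f where "f = (\<lambda>x. (x, - poly Q x / 2))"
  have "finite R" unfolding R_def by (rule poly_roots_finite[OF assms(3)])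
  have "{(x, y). y\<^sup>2 + poly Q x * y = poly P x \<and> 2 * y + poly Q x = 0} = f ` R"
  proof (intro Set.set_eqI iffI)
    fix z assume "z \<in> {(x, y). y\<^sup>2 + poly Q x * y = poly P x \<and> 2 * y + poly Q x = 0}"
    then obtain x y where z: "z = (x, y)" "poly P x = y\<^sup>2 + poly Q x * y" "2 * y + poly Q x = 0"
      by auto
    then have Q: "poly Q x = - 2 * y" by simp
    have "4 * poly P x + (poly Q x)\<^sup>2 = 0"
      unfolding z(2) Q by (simp add: power2_eq_square)
    then show "z \<in> f ` R"
      using z(1) Q by (auto simp: f_def R_def intro!: image_eqI[of _ _ x])
  next
    fix z assume "z \<in> f ` R"
    then show "z \<in> {(x, y). y\<^sup>2 + poly Q x * y = poly P x \<and> 2 * y + poly Q x = 0}"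
      by (auto simp: f_def R_def power2_eq_square field_simps)
  qed
  then have "rat_weierstrass_points P Q = Inl ` f ` R \<union> {Inr 0}"
    using assms(1,2) unfolding rat_weierstrass_points_def by auto
  moreover have "card (Inl ` f ` R :: (_ + rat) set) = card R"
    by (subst card_image card_image, auto simp: inj_on_def f_def card_image)
  ultimately show ?thesis
    using \<open>finite R\<close> by (simp add: R_def card_insert_if image_iff)
qed

text \<open>The sextic convention contributes \<open>4^2\<close>, the division by the leading
  coefficient \<open>1/4\<close>, and the resultant formula another 4; against \<open>2^-12\<close>
  this leaves \<open>2^-8\<close>. The sign is \<open>(-1)^10\<close>.\<close>

lemma weq_disc_quintic:
  fixes P Q l m n b c
  defines "q \<equiv> [:c, b, 4:]"
  assumes F: "Polynomial.smult 4 P + Q\<^sup>2 = [:- l, 1:] * [:- m, 1:] * [:- n, 1:] * q"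
  shows "2 ^ 8 * weq_disc P Q =
    ((l - m) * (l - n) * (m - n))\<^sup>2 * (b\<^sup>2 - 16 * c) * (poly q l * poly q m * poly q n)\<^sup>2"
proof -
  define F where "F = [:- l, 1:] * [:- m, 1:] * [:- n, 1:] * q"
  have "F \<noteq> 0" "degree F = 5" unfolding F_def q_def by (simp_all add: degree_mult_eq)
  moreover have "lead_coeff F = 4"
    unfolding F_def q_def lead_coeff_mult by simp
  moreover have "weq_disc P Q = disc6 F / 2 ^ 12"
    unfolding weq_disc_def F F_def ..
  ultimately have "2 ^ 8 * weq_disc P Q = resultant F (pderiv F) / 4"
    by (simp add: disc6_def poly_disc_def)
  also have "resultant F (pderiv F) = 4 * ((l - m) * (l - n) * (m - n))\<^sup>2 * (b\<^sup>2 - 4 * 4 * c) *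
      (poly q l * poly q m * poly q n)\<^sup>2"
    unfolding F_def q_def by (rule resultant_pderiv_three_roots) simp
  finally show ?thesis by simp
qed

lemma poly_eq_coeffs_degree_le_2:
  "degree Q \<le> 2 \<Longrightarrow> Q = [:coeff Q 0, coeff Q 1, coeff Q 2:]"
  by (intro poly_eqI) (auto simp: coeff_pCons numeral_2_eq_2 coeff_eq_0 split: nat.splits)

lemma poly_eq_coeffs_degree_le_5:
  "degree P \<le> 5 \<Longrightarrow> P = [:coeff P 0, coeff P 1, coeff P 2, coeff P 3, coeff P 4, coeff P 5:]"
  by (intro poly_eqI) (auto simp: coeff_pCons numeral_eq_Suc coeff_eq_0 split: nat.splits)

section \<open>Case distinction on the three affine Weierstrass points\<close>

theorem theorem5p1:
  fixes P Q :: "int poly"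
  assumes "is_weq (map_poly of_int P) (map_poly of_int Q)"
    and "card (rat_weierstrass_points (map_poly of_int P) (map_poly of_int Q)) = 4"
    and "globally_minimal (map_poly of_int P) (map_poly of_int Q)"
    and "degree Q \<le> 2"
    and "degree P = 5" and "lead_coeff P = 1"
  shows "\<not> (\<exists>p::nat. prime p \<and> odd p \<and>
           \<bar>weq_disc (map_poly of_int P) (map_poly of_int Q)\<bar> = of_nat p)"
proof
  assume "\<exists>p::nat. prime p \<and> odd p \<and>
           \<bar>weq_disc (map_poly of_int P) (map_poly of_int Q)\<bar> = of_nat p"
  then obtain p :: nat where "prime p" "odd p"
    and disc: "\<bar>weq_disc (map_poly of_int P) (map_poly of_int Q)\<bar> = of_int (int p)"
    by auto
  then have p: "prime (int p)" "odd (int p)" by auto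
  \<comment> \<open>These are the coefficients of \<open>4P + Q^2\<close>. Modulo 4,
    \<open>f4\<close> is the square of the leading term of \<open>Q\<close> and \<open>f3\<close> is
    twice a multiple of it.\<close>
  define f0 f1 f2 f3 f4 where f:
    "f0 = 4 * coeff P 0 + (coeff Q 0)\<^sup>2"
    "f1 = 4 * coeff P 1 + 2 * coeff Q 0 * coeff Q 1"
    "f2 = 4 * coeff P 2 + (coeff Q 1)\<^sup>2 + 2 * coeff Q 0 * coeff Q 2"
    "f3 = 4 * coeff P 3 + 2 * coeff Q 1 * coeff Q 2"
    "f4 = 4 * coeff P 4 + (coeff Q 2)\<^sup>2"
  have f3: "even f3" unfolding f by simp
  have f4: "4 dvd f4 \<and> 4 dvd f3" if "even f4"
  proof -
    have "even (coeff Q 2)" using that unfolding f by simp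
    then obtain k where "coeff Q 2 = 2 * k" by blast
    then show ?thesis unfolding f by (simp add: power2_eq_square)
  qed
  have PQ: "P = [:coeff P 0, coeff P 1, coeff P 2, coeff P 3, coeff P 4, 1:]"
    "Q = [:coeff Q 0, coeff Q 1, coeff Q 2:]"
    using poly_eq_coeffs_degree_le_5[of P] poly_eq_coeffs_degree_le_2[of Q] assms(4-6) by simp_all
  have "Polynomial.smult 4 P + Q\<^sup>2 = [:f0, f1, f2, f3, f4, 4:]"
    by (subst (1) PQ, subst (1) PQ) (simp add: f power2_eq_square algebra_simps)
  then have "map_poly of_int (Polynomial.smult 4 P + Q\<^sup>2) =
      (map_poly of_int [:f0, f1, f2, f3, f4, 4:] :: rat poly)"
    by simp
  then have F: "Polynomial.smult 4 (map_poly of_int P) + (map_poly of_int Q)\<^sup>2 =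
      (map_poly of_int [:f0, f1, f2, f3, f4, 4:] :: rat poly)" (is "?F = _")
    by (simp add: of_int_poly_hom.hom_add of_int_poly_hom.hom_power of_int_hom.map_poly_hom_smult)
  also have F': "\<dots> = [:of_int f0, of_int f1, of_int f2, of_int f3, of_int f4, 4:]"
    by (simp add: map_poly_pCons)
  finally have "?F \<noteq> 0" by simp
  moreover have "coeff P 6 = 0" "coeff Q 3 = 0" using assms(4,5) by (simp_all add: coeff_eq_0)
  ultimately have "card {x. poly ?F x = 0} = 3"
    using assms(2) by (subst (asm) card_rat_weierstrass_points) (simp_all add: coeff_map_poly)
  then obtain x y z where xyz: "{x. poly ?F x = 0} = {x, y, z}" "x \<noteq> y" "x \<noteq> z" "y \<noteq> z"
    by (auto simp: card_3_iff)
  define root where "root w \<longleftrightarrow> poly ?F w = 0" for w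
  have roots: "root x" "root y" "root z" using xyz(1) unfolding root_def by auto
  have int_or_quarter: "w \<in> \<int> \<or> (\<exists>u. odd u \<and> w = of_int u / 4)" if "root w" for w
    using rational_root_integer_or_odd_quarter[of f0 f1 f2 f3 f4 w] that f3 f4
    unfolding root_def F by blast
  have quarter_unique: "u = v" if "root (of_int u / 4)" "root (of_int v / 4)" "odd u" "odd v" for u v
    using odd_quarter_root_unique[of f0 f1 f2 f3 f4 u v] that unfolding root_def F by blast
  have disc_eq: "\<bar>((l - m) * (l - n) * (m - n))\<^sup>2 * (b\<^sup>2 - 16 * c) *
      (poly [:c, b, 4:] l * poly [:c, b, 4:] m * poly [:c, b, 4:] n)\<^sup>2\<bar> = 2 ^ 8 * of_int (int p)"
    if "root l" "root m" "root n" "l \<noteq> m" "l \<noteq> n" "m \<noteq> n"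
      and b: "b = of_int f4 + 4 * (l + m + n)"
      and c: "c = of_int f3 + b * (l + m + n) - 4 * (l * m + l * n + m * n)" for l m n b c
  proof -
    have "?F = [:- l, 1:] * [:- m, 1:] * [:- n, 1:] * [:c, b, 4:]"
      unfolding F F' b c using that(1-6)[unfolded root_def F F']
      by (intro quintic_with_three_roots)
    from weq_disc_quintic[OF this] show ?thesis
      using disc by (simp only: flip: \<open>2 ^ 8 * weq_disc _ _ = _\<close>) (simp add: abs_mult)
  qed
  have two_integral: False
    if "root (of_int u / 4)" "root m'" "root n'" "m' \<in> \<int>" "n' \<in> \<int>" "m' \<noteq> n'" "odd u" for u m' n'
  proof -
    obtain m n where mn: "m' = of_int m" "n' = of_int n" 
      using \<open>m' \<in> \<int>\<close> \<open>n' \<in> \<int>\<close> by (metis Ints_cases)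
    have quarter: "of_int u / 4 \<noteq> (of_int k :: rat)" for k
    proof
      assume "of_int u / 4 = (of_int k :: rat)"
      then have "(of_int u :: rat) = of_int (4 * k)" by (simp add: field_simps)
      then have "u = 4 * k" by (simp only: of_int_eq_iff)
      then show False using \<open>odd u\<close> by simp
    qed
    \<comment> \<open>Substituting the roots \<open>u/4\<close>, \<open>m\<close>, \<open>n\<close>
      into the cofactor formulas gives an integral \<open>b\<close>; \<open>c\<close> is four times
      the constant coefficient.\<close>
    define b where "b = f4 + u + 4 * (m + n)"
    define c where "c = 4 * f3 + b * (u + 4 * (m + n)) - 4 * (u * (m + n) + 4 * m * n)"
    have "\<bar>((of_int u / 4 - of_int m) * (of_int u / 4 - of_int n) * (of_int m - of_int n))\<^sup>2 *
        ((of_int b)\<^sup>2 - 16 * (of_int c / 4)) *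
        (poly [:of_int c / 4, of_int b, 4:] (of_int u / 4) * poly [:of_int c / 4, of_int b, 4:] (of_int m) *
         poly [:of_int c / 4, of_int b, 4:] (of_int n))\<^sup>2\<bar> = 2 ^ 8 * (of_int (int p) :: rat)"
    proof (rule disc_eq)
      show "of_int b = of_int f4 + 4 * (of_int u / 4 + of_int m + of_int n :: rat)"
        by (simp add: b_def algebra_simps)
      show "of_int c / 4 = of_int f3 + of_int b * (of_int u / 4 + of_int m + of_int n) -
          4 * (of_int u / 4 * of_int m + of_int u / 4 * of_int n + of_int m * of_int n :: rat)"
        by (simp add: c_def field_simps)
    qed (use that mn quarter in simp_all)
    moreover have "poly [:of_int c / 4, of_int b, 4:] w = 4 * w\<^sup>2 + of_int b * w + of_int c / 4" for w :: rat
      by (simp add: power2_eq_square algebra_simps)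
    moreover have "16 * (of_int c / 4) = (4 * of_int c :: rat)" by simp
    moreover have "m \<noteq> n" using that mn by simp
    ultimately show False
      using no_prime_discriminant_two_integral_roots[of u m n "int p" b c] p(1) \<open>odd u\<close> by metis
  qed
  have three_integral: False
    if "root (of_int l)" "root (of_int m)" "root (of_int n)" "l < m" "m < n" for l m n :: int
  proof -
    define b where "b = f4 + 4 * (l + m + n)"
    define c where "c = f3 + b * (l + m + n) - 4 * (l * m + l * n + m * n)"
    have "\<bar>((of_int l - of_int m) * (of_int l - of_int n) * (of_int m - of_int n))\<^sup>2 *
        ((of_int b)\<^sup>2 - 16 * of_int c) *
        (poly [:of_int c, of_int b, 4:] (of_int l) * poly [:of_int c, of_int b, 4:] (of_int m) *
         poly [:of_int c, of_int b, 4:] (of_int n))\<^sup>2\<bar> = 2 ^ 8 * (of_int (int p) :: rat)"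
      using that by (intro disc_eq) (simp_all add: b_def c_def)
    moreover have "poly [:of_int c, of_int b, 4:] (of_int w) = (of_int (4 * w\<^sup>2 + b * w + c) :: rat)" for w
      by (simp add: power2_eq_square algebra_simps)
    ultimately have "of_int \<bar>((l - m) * (l - n) * (m - n))\<^sup>2 * (b\<^sup>2 - 16 * c) *
        ((4 * l\<^sup>2 + b * l + c) * (4 * m\<^sup>2 + b * m + c) * (4 * n\<^sup>2 + b * n + c))\<^sup>2\<bar> =
        (of_int (2 ^ 8 * int p) :: rat)"
      by (simp add: add_ac)
    then have "\<bar>((l - m) * (l - n) * (m - n))\<^sup>2 * (b\<^sup>2 - 16 * c) *
        ((4 * l\<^sup>2 + b * l + c) * (4 * m\<^sup>2 + b * m + c) * (4 * n\<^sup>2 + b * n + c))\<^sup>2\<bar> = 2 ^ 8 * int p"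
      by (simp only: of_int_eq_iff)
    then show False
      by (intro no_prime_discriminant_three_integral_roots[OF b_def c_def f4 f3 that(4,5) p])
  qed
  \<comment> \<open>If one root were an odd quarter, uniqueness would make the other two integral,
    which \<open>two_integral\<close> excludes.\<close>
  have "x \<in> \<int> \<and> y \<in> \<int> \<and> z \<in> \<int>"
    using int_or_quarter[OF roots(1)] int_or_quarter[OF roots(2)] int_or_quarter[OF roots(3)]
      two_integral quarter_unique roots xyz(2-4) by metis
  then obtain i j k where "x = of_int i" "y = of_int j" "z = of_int k"
    by (metis Ints_cases)
  \<comment> \<open>Whatever the order of the three distinct integers, sorting them gives an
    instance of \<open>three_integral\<close>.\<close>
  with roots xyz(2-4) three_integral show False
    by (metis linorder_neqE of_int_eq_iff)
qed

end
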